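(* Let $n\ge 3$ be an integer, let $p_1,\ldots,p_n$ be distinct prime numbers, let $S=\{p_1,\ldots,p_n\}$ and $\mathbb{Z}_S=\mathbb{Z}[\frac1{p_1},\ldots,\frac1{p_n}]$, and let $N,N'$ be arbitrary positive integers. Let $\lambda,\lambda'\in\mathbb{Z}_S^\times\times\mathbb{Z}_S^\times$ and $\Lambda,\Lambda'\subset\mathbb{Z}_S^\times\times\mathbb{Z}_S^\times$ be as defined in the context. For each prime $p\notin S$, let $r_p:\mathbb{Z}_S^\times\times\mathbb{Z}_S^\times\to\mathbb{F}_p^\times\times\mathbb{F}_p^\times$ be the natural reduction map. Then for all primes $p\notin S$: $$r_p(\lambda)\in r_p(\Lambda\cap\Lambda')\quad\text{and}\quad r_p(\lambda')\in r_p(\Lambda\cap\Lambda').$$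
   Context: Elements of $\mathbb{Z}_S^\times\times\mathbb{Z}_S^\times$ are written as column vectors, with componentwise multiplication. Put $$\lambda=\begin{bmatrix}1\\ p_1^{N}\end{bmatrix},\quad \lambda_1=\begin{bmatrix}p_1\\ 1\end{bmatrix},\quad \lambda_i=\begin{bmatrix}p_i\\ p_{i-1}\end{bmatrix}\ (2\le i\le n),\quad \lambda_{n+1}=\begin{bmatrix}1\\ p_n\end{bmatrix},\quad \lambda'=\begin{bmatrix}p_n^{N'}\\ 1\end{bmatrix},$$ $$\Lambda=\lambda^{\mathbb{Z}}\cdot\lambda_1^{\mathbb{Z}}\cdot\lambda_2^{\mathbb{Z}}\cdots\lambda_{n+1}^{\mathbb{Z}},\qquad \Lambda'=\lambda_1^{\mathbb{Z}}\cdot\lambda_2^{\mathbb{Z}}\cdots\lambda_{n+1}^{\mathbb{Z}}\cdot\lambda'^{\mathbb{Z}}.$$ The elements $\lambda,\lambda_1,\ldots,\lambda_{n+1},\lambda'$ are linearly independent over $\mathbb{Z}$, so $\Lambda\cap\Lambda'=\lambda_1^{\mathbb{Z}}\cdot\lambda_2^{\mathbb{Z}}\cdots\lambda_{n+1}^{\mathbb{Z}}$. *)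

theory Defs
  imports
    "HOL-Algebra.Generated_Rings"
    "HOL-Algebra.Algebraic_Closure_Type"
    "HOL-Number_Theory.Residues"
begin

text \<open>
  \<open>ZS S\<close> is \<open>\<int>[1/p | p \<in> S]\<close>, as a subring of \<open>\<rat>\<close>; \<open>ZS_units2 S\<close> is the group
  \<open>\<int>\<^sub>S\<^sup>\<times> \<times> \<int>\<^sub>S\<^sup>\<times>\<close>. A column vector is a pair whose first component is the upper entry.
\<close>

definition ZS :: "nat set \<Rightarrow> rat ring" where
  "ZS S = ring_of_type_algebra
     \<lparr>carrier := generate_ring ring_of_type_algebra ((\<lambda>p. 1 / rat_of_nat p) ` S)\<rparr>"

definition ZS_units2 :: "nat set \<Rightarrow> (rat \<times> rat) monoid" where
  "ZS_units2 S = units_of (ZS S) \<times>\<times> units_of (ZS S)"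

definition lam :: "(nat \<Rightarrow> nat) \<Rightarrow> nat \<Rightarrow> rat \<times> rat" where
  "lam p N = (1, rat_of_nat (p 1) ^ N)"

definition lam_mid :: "(nat \<Rightarrow> nat) \<Rightarrow> nat \<Rightarrow> nat \<Rightarrow> rat \<times> rat" where
  "lam_mid p n i =
     (if i = 1 then (rat_of_nat (p 1), 1)
      else if i \<le> n then (rat_of_nat (p i), rat_of_nat (p (i - 1)))
      else (1, rat_of_nat (p n)))"

definition lam' :: "(nat \<Rightarrow> nat) \<Rightarrow> nat \<Rightarrow> nat \<Rightarrow> rat \<times> rat" where
  "lam' p n N' = (rat_of_nat (p n) ^ N', 1)"

definition int_powers :: "('a, 'b) monoid_scheme \<Rightarrow> 'a \<Rightarrow> 'a set" where
  "int_powers G g = range (\<lambda>k::int. g [^]\<^bsub>G\<^esub> k)"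

text \<open>The product set \<open>g\<^sub>1\<^sup>\<int> \<cdot> g\<^sub>2\<^sup>\<int> \<cdots> g\<^sub>m\<^sup>\<int>\<close>:\<close>

definition prod_int_powers :: "('a, 'b) monoid_scheme \<Rightarrow> 'a list \<Rightarrow> 'a set" where
  "prod_int_powers G gs = foldr (\<lambda>g H. int_powers G g <#>\<^bsub>G\<^esub> H) gs {\<one>\<^bsub>G\<^esub>}"

definition Lam :: "(nat \<Rightarrow> nat) \<Rightarrow> nat \<Rightarrow> nat \<Rightarrow> (rat \<times> rat) set" where
  "Lam p n N = prod_int_powers (ZS_units2 (p ` {1..n}))
     (lam p N # map (lam_mid p n) [1..<n + 2])"

definition Lam' :: "(nat \<Rightarrow> nat) \<Rightarrow> nat \<Rightarrow> nat \<Rightarrow> (rat \<times> rat) set" where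
  "Lam' p n N' = prod_int_powers (ZS_units2 (p ` {1..n}))
     (map (lam_mid p n) [1..<n + 2] @ [lam' p n N'])"

text \<open>
  Reduction modulo a prime \<open>q\<close>: a fraction \<open>a/b\<close> in lowest terms goes to \<open>a \<cdot> b\<^sup>-\<^sup>1\<close> in
  \<open>\<int>/q\<close>, which is meaningful when \<open>q\<close> does not divide \<open>b\<close>. Lemmas \<open>red_ring_hom\<close> and
  \<open>red_unique\<close> below show that for a prime \<open>q \<notin> S\<close> this is the unique ring homomorphism
  from \<open>\<int>\<^sub>S\<close> to the field with \<open>q\<close> elements.
\<close>

definition red :: "nat \<Rightarrow> rat \<Rightarrow> int" where
  "red q x = (let (a, b) = quotient_of x; F = residue_ring (int q)
              in (a mod int q) \<otimes>\<^bsub>F\<^esub> inv\<^bsub>F\<^esub> (b mod int q))"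

definition red2 :: "nat \<Rightarrow> rat \<times> rat \<Rightarrow> int \<times> int" where
  "red2 q = map_prod (red q) (red q)"


lemma ZS_simps [simp]:
  "x \<otimes>\<^bsub>ZS S\<^esub> y = x * y" "x \<oplus>\<^bsub>ZS S\<^esub> y = x + y" "\<one>\<^bsub>ZS S\<^esub> = 1" "\<zero>\<^bsub>ZS S\<^esub> = 0"
  by (simp_all add: ZS_def ring_of_type_algebra_def)

lemma cring_ZS: "cring (ZS S)"
proof -
  interpret Q: cring "ring_of_type_algebra :: rat ring" by (rule cring_from_type_algebra)
  have "subring (generate_ring ring_of_type_algebra ((\<lambda>p. 1 / rat_of_nat p) ` S))
          (ring_of_type_algebra :: rat ring)"
    by (rule Q.generate_ring_is_subring) (simp add: ring_of_type_algebra_def)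
  then have "subcring (generate_ring ring_of_type_algebra ((\<lambda>p. 1 / rat_of_nat p) ` S))
          (ring_of_type_algebra :: rat ring)"
    by (rule Q.subcringI')
  then show ?thesis
    unfolding ZS_def using Q.subcring_iff
    by (simp add: ring_of_type_algebra_def)
qed

lemma comm_group_ZS_units2: "comm_group (ZS_units2 S)"
proof -
  interpret cring "ZS S" by (rule cring_ZS)
  have "comm_group (units_of (ZS S))" by (rule units_comm_group)
  then show ?thesis unfolding ZS_units2_def
    by (intro group.group_comm_groupI DirProd_group)
      (auto simp: DirProd_def comm_group.axioms comm_monoid.m_comm[OF comm_group.axioms(1)])
qed

lemma of_int_in_ZS: "of_int k \<in> carrier (ZS S)"
proof -
  interpret cring "ZS S" by (rule cring_ZS)
  have nat: "of_nat m \<in> carrier (ZS S)" for m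
  proof (induction m)
    case 0 then show ?case using zero_closed by simp
  next
    case (Suc m) then show ?case using a_closed[OF one_closed Suc] by simp
  qed
  have neg: "- x \<in> carrier (ZS S)" if "x \<in> carrier (ZS S)" for x
  proof -
    have "\<ominus>\<^bsub>ZS S\<^esub> x = - x" using l_neg[OF that] by (simp add: eq_neg_iff_add_eq_0)
    then show ?thesis using a_inv_closed[OF that] by simp
  qed
  show ?thesis
  proof (cases "0 \<le> k")
    case True then show ?thesis using nat[of "nat k"] by simp
  next
    case False then show ?thesis using neg[OF nat[of "nat (- k)"]] by simp
  qed
qed

lemma of_nat_in_Units_ZS:
  assumes "m \<in> S" "0 < m"
  shows "rat_of_nat m \<in> Units (ZS S)"
proof -
  have "1 / rat_of_nat m \<in> carrier (ZS S)"
    using assms(1) by (auto simp: ZS_def intro!: generate_ring.incl)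
  moreover have "rat_of_nat m \<in> carrier (ZS S)" using of_int_in_ZS[of "int m" S] by simp
  ultimately show ?thesis using assms(2) unfolding Units_def
    by (auto intro!: bexI[of _ "1 / rat_of_nat m"])
qed

lemma not_dvd_denom_ZS:
  assumes "prime q" "q \<notin> S" "\<forall>p\<in>S. prime p" "x \<in> carrier (ZS S)"
  shows "\<exists>a b. x = of_int a / of_int b \<and> \<not> int q dvd b"
proof -
  have pq: "prime (int q)" using assms(1) by simp
  have "x \<in> generate_ring ring_of_type_algebra ((\<lambda>p. 1 / rat_of_nat p) ` S)"
    using assms(4) by (simp add: ZS_def)
  then show ?thesis
  proof induction
    case one show ?case using pq
      by (intro exI[of _ 1]) (auto simp: ring_of_type_algebra_def)
  next
    case (incl h)
    then obtain p where p: "p \<in> S" "h = 1 / rat_of_nat p" by auto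
    then have "\<not> q dvd p" using assms(1-3) primes_dvd_imp_eq by blast
    then show ?case using p(2)
      by (intro exI[of _ 1] exI[of _ "int p"]) auto
  next
    case (a_inv h)
    interpret Q: cring "ring_of_type_algebra :: rat ring" by (rule cring_from_type_algebra)
    have "\<ominus>\<^bsub>ring_of_type_algebra\<^esub> h = - h"
      using Q.l_neg[of h] by (simp add: ring_of_type_algebra_def eq_neg_iff_add_eq_0)
    then show ?case using a_inv.IH by (metis minus_divide_left of_int_minus)
  next
    case (eng_add h1 h2)
    then obtain a b c d where "h1 = of_int a / of_int b" "\<not> int q dvd b"
      "h2 = of_int c / of_int d" "\<not> int q dvd d" by blast
    moreover from this have "b \<noteq> 0" "d \<noteq> 0" by auto
    ultimately show ?case using prime_dvd_mult_iff[OF pq]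
      by (intro exI[of _ "a * d + c * b"] exI[of _ "b * d"])
        (auto simp: ring_of_type_algebra_def field_simps)
  next
    case (eng_mult h1 h2)
    then obtain a b c d where "h1 = of_int a / of_int b" "\<not> int q dvd b"
      "h2 = of_int c / of_int d" "\<not> int q dvd d" by blast
    then show ?case using prime_dvd_mult_iff[OF pq]
      by (intro exI[of _ "a * c"] exI[of _ "b * d"])
        (auto simp: ring_of_type_algebra_def)
  qed
qed

lemma red_eqI:
  assumes q: "prime q" and b: "\<not> int q dvd b"
    and y: "y \<in> carrier (residue_ring (int q))" "[y * b = a] (mod int q)"
  shows "red q (of_int a / of_int b) = y"
proof -
  interpret residues_prime q "residue_ring (int q)" using q by unfold_locales simp_all
  have pq: "prime (int q)" using q by simp
  obtain c d where cd: "quotient_of (of_int a / of_int b) = (c, d)" by fastforce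
  have d0: "d > 0" using quotient_of_denom_pos[OF cd] .
  have b0: "b \<noteq> 0" using b by auto
  have "rat_of_int a / of_int b = of_int c / of_int d" using quotient_of_div[OF cd] .
  then have "rat_of_int (a * d) = of_int (c * b)" using b0 d0 by (simp add: field_simps)
  then have e: "a * d = c * b" by (simp only: of_int_eq_iff)
  have nd: "\<not> int q dvd d"
  proof
    assume "int q dvd d"
    then have "int q dvd c * b" using e by (metis dvd_mult)
    then have "int q dvd c" using b pq prime_dvd_mult_iff by blast
    then show False using \<open>int q dvd d\<close> quotient_of_coprime[OF cd] pq
      by (meson coprime_common_divisor not_prime_unit)
  qed
  have "[y * d * b = a * d] (mod int q)" using y(2)
    by (metis cong_scalar_right mult.assoc mult.commute)
  then have "[y * d * b = c * b] (mod int q)" using e by simp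
  moreover have cop: "coprime b (int q)"
    using prime_imp_coprime[OF pq b] by (simp add: coprime_commute)
  ultimately have yd: "[y * d = c] (mod int q)" by (simp add: cong_mult_rcancel)
  have dU: "d mod int q \<in> Units (residue_ring (int q))"
  proof -
    have "coprime (d mod int q) (int q)"
      using prime_imp_coprime[OF pq nd] prime_gt_0_int[OF pq]
      by (metis coprime_commute coprime_iff_gcd_eq_1 gcd_red_int)
    moreover have "0 < d mod int q" "d mod int q < int q"
      using nd prime_gt_0_int[OF pq] by (simp_all add: dvd_eq_mod_eq_0 pos_mod_sign order.not_eq_order_implies_strict)
    ultimately show ?thesis by (simp add: res_units_eq)
  qed
  have "y \<otimes>\<^bsub>residue_ring (int q)\<^esub> (d mod int q) = c mod int q"
    using yd by (simp add: res_mult_eq cong_def mod_simps)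
  then have "(c mod int q) \<otimes>\<^bsub>residue_ring (int q)\<^esub> inv\<^bsub>residue_ring (int q)\<^esub> (d mod int q) = y"
    using dU y(1) by (metis Units_closed Units_inv_closed Units_r_inv m_assoc r_one)
  then show ?thesis by (simp add: red_def cd)
qed

lemma red_fraction:
  assumes q: "prime q" and b: "\<not> int q dvd b"
  shows "red q (of_int a / of_int b) \<in> carrier (residue_ring (int q))"
    and "[red q (of_int a / of_int b) * b = a] (mod int q)"
proof -
  have pq: "prime (int q)" using q by simp
  interpret residues_prime q "residue_ring (int q)" using q by unfold_locales simp_all
  have "coprime b (int q)" using prime_imp_coprime[OF pq b] by (simp add: coprime_commute)
  then obtain z where z: "[b * z = 1] (mod int q)" using cong_solve_coprime_int by blast
  define y where "y = (z * a) mod int q"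
  have "[y * b = z * a * b] (mod int q)" by (simp add: y_def cong_def mod_simps)
  also have "z * a * b = (b * z) * a" by simp
  also have "[(b * z) * a = 1 * a] (mod int q)" using z by (rule cong_scalar_right)
  finally have 1: "[y * b = a] (mod int q)" by simp
  have 2: "y \<in> carrier (residue_ring (int q))"
    using prime_gt_0_int[OF pq] by (simp add: y_def res_carrier_eq)
  show "red q (of_int a / of_int b) \<in> carrier (residue_ring (int q))"
    "[red q (of_int a / of_int b) * b = a] (mod int q)"
    using 1 2 red_eqI[OF q b 2 1] by simp_all
qed

lemma red_ring_hom:
  assumes q: "prime q" and S: "q \<notin> S" "\<forall>p\<in>S. prime p"
  shows "red q \<in> ring_hom (ZS S) (residue_ring (int q))"
proof -
  have pq: "prime (int q)" using q by simp
  interpret F: residues_prime q "residue_ring (int q)" using q by unfold_locales simp_all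
  note * = red_fraction[OF q]
  show ?thesis
  proof (rule ring_hom_memI)
    fix x assume "x \<in> carrier (ZS S)"
    from not_dvd_denom_ZS[OF q S this]
    obtain a b where "x = of_int a / of_int b" "\<not> int q dvd b" by blast
    then show "red q x \<in> carrier (residue_ring (int q))" using *(1) by simp
  next
    fix x y assume xy: "x \<in> carrier (ZS S)" "y \<in> carrier (ZS S)"
    obtain a b where x: "x = of_int a / of_int b" "\<not> int q dvd b"
      using not_dvd_denom_ZS[OF q S xy(1)] by blast
    obtain c d where y: "y = of_int c / of_int d" "\<not> int q dvd d"
      using not_dvd_denom_ZS[OF q S xy(2)] by blast
    have bd: "\<not> int q dvd b * d" using x(2) y(2) by (simp add: prime_dvd_mult_iff[OF pq])
    have b0: "b \<noteq> 0" "d \<noteq> 0" using x(2) y(2) by auto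
    have X: "[red q x * b = a] (mod int q)" and Y: "[red q y * d = c] (mod int q)"
      using *(2)[OF x(2)] *(2)[OF y(2)] x(1) y(1) by simp_all
    have XC: "red q x \<in> carrier (residue_ring (int q))"
      and YC: "red q y \<in> carrier (residue_ring (int q))"
      using *(1)[OF x(2)] *(1)[OF y(2)] x(1) y(1) by simp_all
    have "[(red q x * red q y) * (b * d) = a * c] (mod int q)"
      using cong_mult[OF X Y] by (simp add: mult_ac)
    then have "[(red q x \<otimes>\<^bsub>residue_ring (int q)\<^esub> red q y) * (b * d) = a * c] (mod int q)"
      by (simp add: F.res_mult_eq cong_def mod_simps)
    then have "red q (of_int (a * c) / of_int (b * d))
        = red q x \<otimes>\<^bsub>residue_ring (int q)\<^esub> red q y"
      by (intro red_eqI[OF q bd] F.m_closed XC YC)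
    then show "red q (x \<otimes>\<^bsub>ZS S\<^esub> y) = red q x \<otimes>\<^bsub>residue_ring (int q)\<^esub> red q y"
      by (simp add: x(1) y(1))
    have "[(red q x * b) * d + (red q y * d) * b = a * d + c * b] (mod int q)"
      by (intro cong_add cong_scalar_right X Y)
    also have "(red q x * b) * d + (red q y * d) * b = (red q x + red q y) * (b * d)"
      by (simp add: algebra_simps)
    finally have "[(red q x + red q y) * (b * d) = a * d + c * b] (mod int q)" .
    then have "[(red q x \<oplus>\<^bsub>residue_ring (int q)\<^esub> red q y) * (b * d) = a * d + c * b] (mod int q)"
      by (simp add: F.res_add_eq cong_def mod_simps)
    then have "red q (of_int (a * d + c * b) / of_int (b * d))
        = red q x \<oplus>\<^bsub>residue_ring (int q)\<^esub> red q y"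
      by (intro red_eqI[OF q bd] F.a_closed XC YC)
    moreover have "x + y = of_int (a * d + c * b) / of_int (b * d)"
      using b0 by (simp add: x(1) y(1) add_frac_eq)
    ultimately show "red q (x \<oplus>\<^bsub>ZS S\<^esub> y) = red q x \<oplus>\<^bsub>residue_ring (int q)\<^esub> red q y"
      by simp
  next
    have "\<not> int q dvd 1" using pq not_prime_unit by blast
    moreover have "1 \<in> carrier (residue_ring (int q))"
      using F.one_closed unfolding F.res_one_eq .
    ultimately have "red q (of_int 1 / of_int 1) = 1"
      by (rule red_eqI[OF q]) (simp add: cong_def)
    then show "red q \<one>\<^bsub>ZS S\<^esub> = \<one>\<^bsub>residue_ring (int q)\<^esub>" by (simp add: F.res_one_eq)
  qed
qed

lemma red_unique:
  assumes q: "prime q" and S: "q \<notin> S" "\<forall>p\<in>S. prime p"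
    and f: "f \<in> ring_hom (ZS S) (residue_ring (int q))" and x: "x \<in> carrier (ZS S)"
  shows "f x = red q x"
proof -
  have pq: "prime (int q)" using q by simp
  interpret F: residues_prime q "residue_ring (int q)" using q by unfold_locales simp_all
  interpret Z: cring "ZS S" by (rule cring_ZS)
  interpret f: ring_hom_cring "ZS S" "residue_ring (int q)" f
    by unfold_locales (rule f)
  have nat: "f (of_nat m) = int m mod int q" for m
  proof (induction m)
    case 0 then show ?case using f.hom_zero by (simp add: F.res_zero_eq)
  next
    case (Suc m)
    have "f (1 + of_nat m) = f 1 \<oplus>\<^bsub>residue_ring (int q)\<^esub> f (of_nat m)"
      using f.hom_add[of 1 "of_nat m"] of_int_in_ZS[of 1 S] of_int_in_ZS[of "int m" S] by simp
    then show ?case using Suc f.hom_one by (simp add: F.res_add_eq F.res_one_eq mod_simps)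
  qed
  have int: "f (of_int k) = k mod int q" for k
  proof (cases "0 \<le> k")
    case True then show ?thesis using nat[of "nat k"] by simp
  next
    case False
    define z where "z = f (of_int k)"
    have zc: "z \<in> carrier (residue_ring (int q))"
      unfolding z_def by (rule f.hom_closed[OF of_int_in_ZS])
    have "f (of_int k + of_int (- k)) = z \<oplus>\<^bsub>residue_ring (int q)\<^esub> f (of_int (- k))"
      unfolding z_def using f.hom_add[OF of_int_in_ZS of_int_in_ZS, of k "- k"] by simp
    moreover have "f (of_int (- k)) = (- k) mod int q"
      using nat[of "nat (- k)"] False by simp
    moreover have "f (of_int k + of_int (- k)) = 0"
      using f.hom_zero by (simp add: F.res_zero_eq)
    ultimately have "(z - k) mod int q = 0" by (simp add: F.res_add_eq mod_simps)
    then have "z mod int q = k mod int q"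
      by (simp add: mod_eq_dvd_iff mod_eq_0_iff_dvd)
    then show ?thesis using zc by (simp add: z_def F.res_carrier_eq)
  qed
  obtain a b where ab: "x = of_int a / of_int b" "\<not> int q dvd b"
    using not_dvd_denom_ZS[OF q S x] by blast
  then have "x * of_int b = of_int a" by auto
  then have "f x \<otimes>\<^bsub>residue_ring (int q)\<^esub> f (of_int b) = f (of_int a)"
    using f.hom_mult[OF x of_int_in_ZS, of b] by simp
  then have "[f x * b = a] (mod int q)"
    by (simp add: int F.res_mult_eq cong_def mod_simps)
  then show ?thesis
    using red_eqI[OF q ab(2) f.hom_closed[OF x]] ab(1) by simp
qed

lemma red2_hom:
  assumes q: "prime q" and S: "q \<notin> S" "\<forall>p\<in>S. prime p"
  shows "red2 q \<in> hom (ZS_units2 S)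
    (units_of (residue_ring (int q)) \<times>\<times> units_of (residue_ring (int q)))"
proof -
  interpret F: residues_prime q "residue_ring (int q)" using q by unfold_locales simp_all
  interpret Z: cring "ZS S" by (rule cring_ZS)
  interpret f: ring_hom_cring "ZS S" "residue_ring (int q)" "red q"
    by unfold_locales (rule red_ring_hom[OF assms])
  have U: "red q x \<in> Units (residue_ring (int q))" if x: "x \<in> Units (ZS S)" for x
  proof -
    obtain y where y: "y \<in> carrier (ZS S)" "x * y = 1"
      using x by (auto simp: Units_def mult.commute)
    have xc: "x \<in> carrier (ZS S)" using x by (rule Z.Units_closed)
    have "red q x \<otimes>\<^bsub>residue_ring (int q)\<^esub> red q y = \<one>\<^bsub>residue_ring (int q)\<^esub>"
      using f.hom_mult[OF xc y(1)] y(2) f.hom_one by simp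
    then show ?thesis
      using f.hom_closed[OF xc] f.hom_closed[OF y(1)]
        F.m_comm[OF f.hom_closed[OF xc] f.hom_closed[OF y(1)]]
      unfolding Units_def by force
  qed
  have M: "red q (x * y) = red q x \<otimes>\<^bsub>residue_ring (int q)\<^esub> red q y"
    if "x \<in> Units (ZS S)" "y \<in> Units (ZS S)" for x y
    using f.hom_mult[OF Z.Units_closed[OF that(1)] Z.Units_closed[OF that(2)]] by simp
  show ?thesis
    using U M by (auto simp: hom_def ZS_units2_def DirProd_def units_of_def red2_def)
qed

lemma lams_in_carrier:
  assumes "1 \<le> n" "\<forall>i\<in>{1..n}. prime (p i)"
  shows "lam p N \<in> carrier (ZS_units2 (p ` {1..n}))"
    and "lam' p n N' \<in> carrier (ZS_units2 (p ` {1..n}))"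
    and "1 \<le> i \<Longrightarrow> lam_mid p n i \<in> carrier (ZS_units2 (p ` {1..n}))"
proof -
  define S where "S = p ` {1..n}"
  interpret Z: cring "ZS S" by (rule cring_ZS)
  have P: "rat_of_nat (p i) \<in> Units (ZS S)" if "i \<in> {1..n}" for i
    using that assms(2) by (intro of_nat_in_Units_ZS) (auto simp: S_def intro: prime_gt_0_nat)
  have one: "1 \<in> Units (ZS S)" using Z.Units_one_closed by simp
  have pow: "x ^ k \<in> Units (ZS S)" if "x \<in> Units (ZS S)" for x k
  proof (induction k)
    case 0 then show ?case using one by simp
  next
    case (Suc k) then show ?case using Z.Units_m_closed[OF that Suc] by simp
  qed
  note c = ZS_units2_def units_of_def DirProd_def
  show "lam p N \<in> carrier (ZS_units2 (p ` {1..n}))"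
    unfolding S_def[symmetric] using assms(1) by (auto simp: lam_def c intro!: one pow P)
  show "lam' p n N' \<in> carrier (ZS_units2 (p ` {1..n}))"
    unfolding S_def[symmetric] using assms(1) by (auto simp: lam'_def c intro!: one pow P)
  show "lam_mid p n i \<in> carrier (ZS_units2 (p ` {1..n}))" if "1 \<le> i"
    unfolding S_def[symmetric] using that assms(1) by (auto simp: lam_mid_def c intro!: one P)
qed

end

(* The group of units of the field with q elements is cyclic. Let x_i be the residue of p_i for
   1 <= i <= n and x_0 = x_(n+1) = 1, so that the image M of the group generated by the lambda_i
   is generated by the pairs (x_i, x_(i-1)), 1 <= i <= n+1. Both projections of M are the cyclic
   group generated by the x_i; let h be a generator of it and (h, h^e) an element of M over h.
   Powers of this element show that (x_i, x_i^e) is in M, hence (1, x_(i-1) x_i^(-e)) is in M, and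
   descending from x_(n+1) = 1 one finds every (1, x_i), and so every (x_i, 1), in M. *)

theory Submission
  imports Defs
begin

section \<open>Cyclic groups and subgroups of their squares\<close>

text \<open>The exponents \<open>k\<close> with \<open>g [^] k\<close> in \<open>H\<close> form a
  subgroup of the integers, hence consist of the multiples of one integer \<open>d\<close>; then
  \<open>g [^] d\<close> generates \<open>H\<close>.\<close>

lemma (in group) subgroup_of_cyclic:
  assumes g: "g \<in> carrier G" "carrier G = range (\<lambda>k::int. g [^] k)" and H: "subgroup H G"
  obtains h where "h \<in> H" "H = range (\<lambda>k::int. h [^] k)"
proof -
  define A where "A = {k::int. g [^] k \<in> H}"
  have sub: "j - d * k \<in> A" if "j \<in> A" "k \<in> A" for j k d
  proof -
    have "g [^] (j - d * k) = g [^] j \<otimes> inv ((g [^] k) [^] d)"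
      using g(1) by (simp add: int_pow_diff int_pow_pow mult.commute)
    then show ?thesis
      using that subgroup.m_closed[OF H] subgroup.m_inv_closed[OF H] subgroup_int_pow_closed[OF H]
      by (simp add: A_def)
  qed
  obtain d where d: "d \<in> A" "\<And>k. k \<in> A \<Longrightarrow> d dvd k"
  proof (cases "A \<subseteq> {0}")
    case True
    moreover have "0 \<in> A" using subgroup.one_closed[OF H] by (simp add: A_def)
    ultimately show ?thesis using that[of 0] by auto
  next
    case False
    then obtain k where k: "k \<in> A" "k \<noteq> 0" by auto
    \<comment> \<open>Since \<open>k - 2 * k = - k\<close>, a nonzero exponent of either sign yields
      a positive one, so a least positive exponent \<open>m\<close> exists.\<close>
    have "- k \<in> A" using sub[OF k(1) k(1), of 2] by simp
    then have "\<exists>m. 0 < m \<and> int m \<in> A"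
      using k by (intro exI[of _ "nat \<bar>k\<bar>"]) (auto simp: abs_if)
    then obtain m where m: "0 < m" "int m \<in> A" "\<And>l. 0 < l \<Longrightarrow> int l \<in> A \<Longrightarrow> m \<le> l"
      using exists_least_iff[of "\<lambda>m. 0 < m \<and> int m \<in> A"] by (metis not_le)
    have "int m dvd j" if "j \<in> A" for j
    proof (rule ccontr)
      assume nd: "\<not> int m dvd j"
      \<comment> \<open>A nonzero remainder would be a positive exponent smaller than
        \<open>m\<close>.\<close>
      have "j mod int m \<in> A"
        using sub[OF that m(2), of "j div int m"] by (simp add: minus_div_mult_eq_mod)
      moreover have "0 \<le> j mod int m" "j mod int m < int m" "j mod int m \<noteq> 0"
        using m(1) nd by (auto simp: dvd_eq_mod_eq_0)
      ultimately show False using m(3)[of "nat (j mod int m)"] by auto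
    qed
    then show ?thesis using that m(2) by blast
  qed
  have "H = range (\<lambda>k::int. (g [^] d) [^] k)"
  proof (intro equalityI subsetI)
    fix x assume x: "x \<in> H"
    then obtain k :: int where k: "x = g [^] k" using g(2) subgroup.subset[OF H] by blast
    then have "d dvd k" using x d(2) by (simp add: A_def)
    then show "x \<in> range (\<lambda>k::int. (g [^] d) [^] k)"
      using k g(1) by (auto simp: int_pow_pow)
  qed (use d(1) subgroup_int_pow_closed[OF H] in \<open>auto simp: A_def\<close>)
  then show ?thesis using that d(1) by (auto simp: A_def)
qed

lemma int_pow_DirProd:
  fixes k :: int
  assumes "group G" "group H" "x \<in> carrier G" "y \<in> carrier H"
  shows "(x, y) [^]\<^bsub>G \<times>\<times> H\<^esub> k = (x [^]\<^bsub>G\<^esub> k, y [^]\<^bsub>H\<^esub> k)"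
proof -
  interpret G: group G by fact
  interpret H: group H by fact
  interpret P: group "G \<times>\<times> H" by (rule DirProd_group[OF assms(1,2)])
  have xy: "(x, y) \<in> carrier (G \<times>\<times> H)" using assms by simp
  have "fst \<in> hom (G \<times>\<times> H) G" "snd \<in> hom (G \<times>\<times> H) H" by (auto simp: hom_def)
  then have "fst ((x, y) [^]\<^bsub>G \<times>\<times> H\<^esub> k) = x [^]\<^bsub>G\<^esub> k" "snd ((x, y) [^]\<^bsub>G \<times>\<times> H\<^esub> k) = y [^]\<^bsub>H\<^esub> k"
    using hom_int_pow[OF _ xy] P.is_group assms by fastforce+
  then show ?thesis by (simp add: prod_eq_iff)
qed

text \<open>Cyclicity enters through a single exponent \<open>e\<close> such that \<open>M\<close>
  contains the graph of \<open>y \<mapsto> y [^] e\<close> on the whole first projection of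
  \<open>M\<close>. Comparing this graph with consecutive steps of the staircase isolates one
  coordinate at a time.\<close>

lemma (in group) staircase_generates_axes:
  fixes m j :: nat
  assumes g: "g \<in> carrier G" "carrier G = range (\<lambda>k::int. g [^] k)"
    and x: "\<And>i. i \<le> m \<Longrightarrow> x i \<in> carrier G" and ends: "x 0 = \<one>" "x m = \<one>"
    and j: "j \<le> m"
  defines "M \<equiv> generate (G \<times>\<times> G) ((\<lambda>i. (x i, x (i - 1))) ` {1..m})"
  shows "(\<one>, x j) \<in> M" and "(x j, \<one>) \<in> M"
proof -
  interpret P: group "G \<times>\<times> G" by (rule DirProd_group[OF is_group is_group])
  define B where "B = (\<lambda>i. (x i, x (i - 1))) ` {1..m}"
  have B: "B \<subseteq> carrier (G \<times>\<times> G)" by (auto simp: B_def intro!: x)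
  have sM: "subgroup M (G \<times>\<times> G)"
    unfolding M_def B_def[symmetric] by (rule P.generate_is_subgroup[OF B])
  have BM: "(x i, x (i - 1)) \<in> M" if "1 \<le> i" "i \<le> m" for i
    unfolding M_def using that by (auto intro: generate.incl)
  have "group_hom (G \<times>\<times> G) G fst" "group_hom (G \<times>\<times> G) G snd"
    by unfold_locales (auto simp: hom_def)
  then have fM: "fst ` M = generate G (fst ` B)" and sndM: "snd ` M = generate G (snd ` B)"
    unfolding M_def B_def[symmetric] using group_hom.generate_img[OF _ B] by metis+
  define H where "H = fst ` M"
  have fB: "fst ` B \<subseteq> carrier G" using B by auto
  have H: "subgroup H G" unfolding H_def fM by (rule generate_is_subgroup[OF fB])
  have xH: "x i \<in> H" if "i \<le> m" for i
  proof (cases "i = 0")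
    case True
    then show ?thesis using ends(1) subgroup.one_closed[OF H] by simp
  next
    case False
    then show ?thesis using BM[of i] that unfolding H_def by force
  qed
  \<comment> \<open>The second coordinates are \<open>x 0\<close>, ..., \<open>x (m - 1)\<close>.
    All but \<open>x 0\<close> also occur as first coordinates, and \<open>x 0\<close> is the
    identity.\<close>
  have "snd ` B \<subseteq> H" using xH by (auto simp: B_def)
  then have sH: "snd ` M \<subseteq> H" unfolding sndM using generate_subgroup_incl H by blast
  obtain h where h: "h \<in> H" "H = range (\<lambda>k::int. h [^] k)"
    using subgroup_of_cyclic[OF g H] .
  have hG: "h \<in> carrier G" using h(1) subgroup.mem_carrier[OF H] by blast
  \<comment> \<open>Any element of \<open>M\<close> over the generator \<open>h\<close> will do: its
    second coordinate lies in \<open>H\<close>, so it is a power of \<open>h\<close>.\<close>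
  obtain c where c: "(h, c) \<in> M" using h(1) unfolding H_def by force
  then obtain e :: int where e: "c = h [^] e" using sH h(2) by force
  \<comment> \<open>If \<open>y\<close> is the \<open>b\<close>-th power of \<open>h\<close>, then
    the \<open>b\<close>-th power of \<open>(h, c)\<close> is \<open>(y, y [^] e)\<close>.\<close>
  have graph: "(y, y [^] e) \<in> M" if "y \<in> H" for y
  proof -
    obtain b :: int where "y = h [^] b" using \<open>y \<in> H\<close> h(2) by auto
    moreover have "(h, c) [^]\<^bsub>G \<times>\<times> G\<^esub> b \<in> M"
      by (rule P.subgroup_int_pow_closed[OF sM c])
    ultimately show ?thesis using hG
      by (simp add: e int_pow_DirProd[OF is_group is_group] int_pow_pow mult.commute)
  qed
  \<comment> \<open>Downward induction starting from \<open>x m = \<one>\<close>.\<close>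
  have axis: "(\<one>, x i) \<in> M" if "i \<le> m" for i
    using that
  proof (induction rule: inc_induct)
    case base
    then show ?case using ends(2) subgroup.one_closed[OF sM] by simp
  next
    case (step i)
    have y: "x (Suc i) \<in> carrier G" "x i \<in> carrier G" using step.hyps x by auto
    have "(x (Suc i), x i) \<in> M" using BM[of "Suc i"] step.hyps by simp
    moreover have "inv\<^bsub>G \<times>\<times> G\<^esub> (x (Suc i), x (Suc i) [^] e) \<in> M"
      using graph xH step.hyps by (intro subgroup.m_inv_closed[OF sM]) simp
    moreover have "(\<one>, x (Suc i)) [^]\<^bsub>G \<times>\<times> G\<^esub> e \<in> M"
      by (rule P.subgroup_int_pow_closed[OF sM step.IH])
    \<comment> \<open>This product equals \<open>(\<one>, x i)\<close>: the graph element cancels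
      \<open>x (Suc i)\<close> on the left, and the induction hypothesis repairs the factor it
      introduces on the right.\<close>
    ultimately have "(x (Suc i), x i) \<otimes>\<^bsub>G \<times>\<times> G\<^esub> (inv\<^bsub>G \<times>\<times> G\<^esub> (x (Suc i), x (Suc i) [^] e)
        \<otimes>\<^bsub>G \<times>\<times> G\<^esub> (\<one>, x (Suc i)) [^]\<^bsub>G \<times>\<times> G\<^esub> e) \<in> M"
      by (intro subgroup.m_closed[OF sM])
    then show ?case using y
      by (simp add: int_pow_DirProd[OF is_group is_group] inv_DirProd[OF is_group is_group])
  qed
  then show "(\<one>, x j) \<in> M" using j .
  show "(x j, \<one>) \<in> M"
  proof (cases "j = 0")
    case True
    then show ?thesis using ends(1) subgroup.one_closed[OF sM] by simp
  next
    case False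
    then have "(x j, x (j - 1)) \<otimes>\<^bsub>G \<times>\<times> G\<^esub> inv\<^bsub>G \<times>\<times> G\<^esub> (\<one>, x (j - 1)) \<in> M"
      using BM[of j] axis[of "j - 1"] j
      by (intro subgroup.m_closed[OF sM] subgroup.m_inv_closed[OF sM]) auto
    then show ?thesis using x[of j] x[of "j - 1"] j
      by (simp add: inv_DirProd[OF is_group is_group])
  qed
qed

section \<open>Product sets of cyclic subgroups, and units of finite fields\<close>

text \<open>In an abelian group a product of subgroups is a subgroup. This makes monotonicity and
  images of generated subgroups available for \<open>Lam\<close> and \<open>Lam'\<close>.\<close>

lemma (in comm_group) prod_int_powers_eq_generate:
  assumes "set gs \<subseteq> carrier G"
  shows "prod_int_powers G gs = generate G (set gs)"
  using assms
proof (induction gs)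
  case Nil
  then show ?case by (simp add: prod_int_powers_def generate_empty)
next
  case (Cons g gs)
  have g: "{g} \<subseteq> carrier G" "set gs \<subseteq> carrier G" using Cons.prems by auto
  have "prod_int_powers G (g # gs) = generate G {g} <#> generate G (set gs)"
    using Cons.IH[OF g(2)] generate_pow[of g] g
    by (simp add: prod_int_powers_def int_powers_def full_SetCompr_eq)
  also have "\<dots> = generate G (set (g # gs))"
  proof (rule generateI)
    show "subgroup (generate G {g} <#> generate G (set gs)) G"
      by (rule mult_subgroups[OF generate_is_subgroup[OF g(1)] generate_is_subgroup[OF g(2)]])
    have "generate G {g} \<subseteq> generate G {g} <#> generate G (set gs)"
      using generate_in_carrier[OF g(1)] generate.one unfolding set_mult_def by force
    moreover have "generate G (set gs) \<subseteq> generate G {g} <#> generate G (set gs)"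
      using generate_in_carrier[OF g(2)] generate.one unfolding set_mult_def by force
    moreover have "g \<in> generate G {g}" "set gs \<subseteq> generate G (set gs)"
      by (auto intro: generate.incl)
    ultimately show "set (g # gs) \<subseteq> generate G {g} <#> generate G (set gs)"
      by auto
  next
    fix E assume E: "subgroup E G" "set (g # gs) \<subseteq> E"
    then have "generate G {g} \<subseteq> E" "generate G (set gs) \<subseteq> E"
      using generate_subgroup_incl by (metis insert_subset list.simps(15) empty_subsetI)+
    then show "generate G {g} <#> generate G (set gs) \<subseteq> E"
      using subgroup.m_closed[OF E(1)] unfolding set_mult_def by blast
  qed
  finally show ?case .
qed

text \<open>The classical cyclicity theorem, moved from natural powers in \<open>R\<close> to
  integer powers in \<open>units_of R\<close>, the form that \<open>staircase_generates_axes\<close>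
  takes.\<close>

lemma (in field) finite_units_of_cyclic:
  assumes "finite (carrier R)"
  obtains g where "g \<in> carrier (units_of R)"
    "carrier (units_of R) = range (\<lambda>k::int. g [^]\<^bsub>units_of R\<^esub> k)"
proof -
  interpret U: group "units_of R" by (rule units_group)
  obtain g where g: "g \<in> carrier (units_of R)" "carrier (units_of R) = {g [^] i | i::nat. i \<in> UNIV}"
    using finite_field_mult_group_has_gen[OF assms] unfolding mult_of_is_Units by blast
  have "g [^] i = g [^]\<^bsub>units_of R\<^esub> int i" for i :: nat
    using g(1) by (simp add: units_of_pow units_of_carrier int_pow_int)
  then have "carrier (units_of R) \<subseteq> range (\<lambda>k::int. g [^]\<^bsub>units_of R\<^esub> k)"
    using g(2) by auto
  then show ?thesis using that[OF g(1)] U.int_pow_closed[OF g(1)] by blast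
qed

section \<open>Reduction modulo a prime outside \<open>S\<close>\<close>

theorem theorem3p3:
  fixes n N N' :: nat and p :: "nat \<Rightarrow> nat"
  assumes "n \<ge> 3"
    and "\<forall>i\<in>{1..n}. prime (p i)"
    and "inj_on p {1..n}"
    and "N > 0" and "N' > 0"
  shows "\<forall>q. prime q \<and> q \<notin> p ` {1..n} \<longrightarrow>
           red2 q (lam p N) \<in> red2 q ` (Lam p n N \<inter> Lam' p n N') \<and>
           red2 q (lam' p n N') \<in> red2 q ` (Lam p n N \<inter> Lam' p n N')"
proof (intro allI impI, elim conjE)
  fix q assume q: "prime q" "q \<notin> p ` {1..n}"
  define S where "S = p ` {1..n}"
  define U where "U = units_of (residue_ring (int q))"
  have S: "\<forall>r\<in>S. prime r" using assms(2) by (auto simp: S_def)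
  have qS: "q \<notin> S" using q(2) by (simp add: S_def)
  interpret F: residues_prime q "residue_ring (int q)" using q(1) by unfold_locales simp_all
  interpret U: group U unfolding U_def by (rule F.units_group)
  interpret UU: group "U \<times>\<times> U" by (rule DirProd_group[OF U.is_group U.is_group])
  interpret Z: comm_group "ZS_units2 S" by (rule comm_group_ZS_units2)
  interpret r: group_hom "ZS_units2 S" "U \<times>\<times> U" "red2 q"
    using red2_hom[OF q(1) qS S] by unfold_locales (simp add: U_def)
  interpret rh: ring_hom_ring "ZS S" "residue_ring (int q)" "red q"
    by (rule ring_hom_ringI2[OF cring.axioms(1)[OF cring_ZS] F.ring_axioms red_ring_hom[OF q(1) qS S]])
  obtain g where g: "g \<in> carrier U" "carrier U = range (\<lambda>k::int. g [^]\<^bsub>U\<^esub> k)"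
    using F.finite_units_of_cyclic F.finite unfolding U_def by blast
  define L where "L = lam_mid p n ` {1..n + 1}"
  have n: "1 \<le> n" using assms(1) by simp
  note carr = lams_in_carrier[OF n assms(2), folded S_def]
  have L: "L \<subseteq> carrier (ZS_units2 S)" using carr(3) by (auto simp: L_def)
  have "{1..<n + 2} = {1..n + 1}" by auto
  then have setL: "set (map (lam_mid p n) [1..<n + 2]) = L" by (simp only: L_def set_map set_upt)
  have "set (lam p N # map (lam_mid p n) [1..<n + 2]) = insert (lam p N) L"
    by (simp only: list.set(2) setL)
  then have "Lam p n N = generate (ZS_units2 S) (insert (lam p N) L)"
    unfolding Lam_def S_def[symmetric] using L carr(1)[of N]
    by (simp only: Z.prod_int_powers_eq_generate insert_subset simp_thms)
  moreover have "set (map (lam_mid p n) [1..<n + 2] @ [lam' p n N']) = insert (lam' p n N') L"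
    by (simp only: set_append list.set setL Un_insert_right Un_empty_right)
  then have "Lam' p n N' = generate (ZS_units2 S) (insert (lam' p n N') L)"
    unfolding Lam'_def S_def[symmetric] using L carr(2)[of N']
    by (simp only: Z.prod_int_powers_eq_generate insert_subset simp_thms)
  \<comment> \<open>Both generating sets contain \<open>L\<close>, so it suffices to find the two
    reductions in the image of the subgroup generated by \<open>L\<close>.\<close>
  ultimately have "generate (ZS_units2 S) L \<subseteq> Lam p n N \<inter> Lam' p n N'"
    using Z.mono_generate[of L] by blast
  then have "red2 q ` generate (ZS_units2 S) L \<subseteq> red2 q ` (Lam p n N \<inter> Lam' p n N')"
    by (rule image_mono)
  moreover have "red2 q ` generate (ZS_units2 S) L = generate (U \<times>\<times> U) (red2 q ` L)"
    by (rule r.generate_img[OF L, symmetric])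
  ultimately have sub: "generate (U \<times>\<times> U) (red2 q ` L) \<subseteq> red2 q ` (Lam p n N \<inter> Lam' p n N')"
    by simp
  have one: "red q 1 = \<one>\<^bsub>U\<^esub>" using rh.hom_one by (simp add: U_def units_of_one)
  \<comment> \<open>The default value at \<open>0\<close> and \<open>n + 1\<close> merges the three
    cases of \<open>lam_mid\<close> into the one formula \<open>(x i, x (i - 1))\<close>.\<close>
  define x where "x i = (if i \<in> {1..n} then red q (rat_of_nat (p i)) else \<one>\<^bsub>U\<^esub>)" for i
  have r_mid: "red2 q (lam_mid p n i) = (x i, x (i - 1))" if "i \<in> {1..n + 1}" for i
    using that one n by (cases "i = n + 1") (auto simp: red2_def lam_mid_def x_def)
  then have rL: "red2 q ` L = (\<lambda>i. (x i, x (i - 1))) ` {1..n + 1}"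
    unfolding L_def image_image by (rule image_cong[OF refl])
  \<comment> \<open>For positive \<open>i\<close>, \<open>x i\<close> is a unit as the first
    coordinate of the reduction of \<open>lam_mid p n i\<close>.\<close>
  have x: "x i \<in> carrier U" if "i \<le> n + 1" for i
  proof (cases "i = 0")
    case False
    then show ?thesis
      using r_mid[of i] r.hom_closed[OF carr(3)[of i]] that by simp
  qed (simp add: x_def)
  \<comment> \<open>The staircase has length \<open>m = n + 1\<close>; the indices
    \<open>j = 1\<close> and \<open>j = n\<close> are the ones occurring in \<open>lam\<close> and
    \<open>lam'\<close>.\<close>
  have M: "(\<one>\<^bsub>U\<^esub>, x 1) \<in> generate (U \<times>\<times> U) (red2 q ` L)"
    "(x n, \<one>\<^bsub>U\<^esub>) \<in> generate (U \<times>\<times> U) (red2 q ` L)"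
    unfolding rL
    by (rule U.staircase_generates_axes[OF g x]; simp add: x_def)+
  have sM: "subgroup (generate (U \<times>\<times> U) (red2 q ` L)) (U \<times>\<times> U)"
    using L r.hom_closed by (intro UU.generate_is_subgroup image_subsetI) blast
  have pow: "red q (rat_of_nat (p i) ^ k) = x i [^]\<^bsub>U\<^esub> int k" if "i \<in> {1..n}" for i k
  proof -
    have pc: "rat_of_nat (p i) \<in> carrier (ZS S)"
      using of_int_in_ZS[of "int (p i)" S] by simp
    have "rat_of_nat (p i) ^ k = rat_of_nat (p i) [^]\<^bsub>ZS S\<^esub> k"
      by (induction k) (simp_all add: mult.commute)
    then show ?thesis
      using rh.hom_nat_pow[OF pc] that x[of i]
      by (simp add: x_def U_def int_pow_int F.units_of_pow units_of_carrier)
  qed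
  \<comment> \<open>Both reductions are powers of the two axis elements just found, so closure under
    powers settles every \<open>N\<close> and \<open>N'\<close>.\<close>
  have "red2 q (lam p N) = (\<one>\<^bsub>U\<^esub>, x 1) [^]\<^bsub>U \<times>\<times> U\<^esub> int N"
    using pow[of 1 N] n one x[of 1]
    by (simp add: lam_def red2_def int_pow_DirProd[OF U.is_group U.is_group])
  moreover have "red2 q (lam' p n N') = (x n, \<one>\<^bsub>U\<^esub>) [^]\<^bsub>U \<times>\<times> U\<^esub> int N'"
    using pow[of n N'] n one x[of n]
    by (simp add: lam'_def red2_def int_pow_DirProd[OF U.is_group U.is_group])
  ultimately show "red2 q (lam p N) \<in> red2 q ` (Lam p n N \<inter> Lam' p n N') \<and>
      red2 q (lam' p n N') \<in> red2 q ` (Lam p n N \<inter> Lam' p n N')"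
    using sub UU.subgroup_int_pow_closed[OF sM M(1)] UU.subgroup_int_pow_closed[OF sM M(2)] by auto
qed

end
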